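(* Let $\tilde N$ be a (finite) positive integer and let $I$ be a discrete gray scale image with $\mu_{0,0}\neq 0$. If $I$ has an $\tilde N$-fold rotation symmetry and $j,l\ge 0$ are integers such that $\frac{l-j}{\tilde N}$ is not an integer, then $\tilde\mu_{j,l}=0$. Conversely, if $\tilde\mu_{j,l}=0$ for all integers $j,l\ge 0$ such that $\frac{l-j}{\tilde N}$ is not an integer, then $I$ has an $\tilde N$-fold rotation symmetry.
   Context: A discrete gray scale image $I=\{(z_k,\rho(z_k))\}_{k=1}^N$ consists of $N$ pairwise distinct pixel locations $z_k\in\mathbb{C}$ and intensities $\rho(z_k)\in\mathbb{R}_{\ge 0}$. Pixels of zero intensity may be added to or deleted from an image freely, so two images are considered equal if their sets of pairs (location, intensity) with nonzero intensity coincide. The complex moments are $\mu_{j,l}=\sum_{k=1}^N z_k^j\bar z_k^l\rho(z_k)$ (with $0^0=1$), the centroid is $z_0=\mu_{1,0}/\mu_{0,0}$, and the centralized moments are $\tilde\mu_{j,l}=\sum_{k=1}^N(z_k-z_0)^j(\bar z_k-\bar z_0)^l\rho(z_k)$. The image has $\tilde N$-fold rotation symmetry if it is unchanged by rotation around its centroid by the angle $\frac{2k\pi}{\tilde N}$, for all $k=1,\dots,\tilde N$ (a rotation moves the pixel locations and carries their intensities along). *)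

theory Defs
  imports Complex_Main
begin

type_synonym image = "(complex \<times> real) set"

text \<open>Injectivity of \<open>fst\<close> expresses that the pixel locations are pairwise distinct. Pixels of
  intensity zero may be present.\<close>

definition gray_image :: "image \<Rightarrow> bool" where
  "gray_image I \<longleftrightarrow> finite I \<and> inj_on fst I \<and> (\<forall>(z, r) \<in> I. r \<ge> 0)"

text \<open>Equality of images up to adding or deleting pixels of intensity zero.\<close>

definition image_eq :: "image \<Rightarrow> image \<Rightarrow> bool" where
  "image_eq I J \<longleftrightarrow> {(z, r) \<in> I. r \<noteq> 0} = {(z, r) \<in> J. r \<noteq> 0}"

definition moment :: "image \<Rightarrow> nat \<Rightarrow> nat \<Rightarrow> complex" where
  "moment I j l = (\<Sum>(z, r)\<in>I. z ^ j * cnj z ^ l * of_real r)"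

text \<open>For an image with vanishing total intensity this is \<open>0\<close>, by division by zero.\<close>

definition centroid :: "image \<Rightarrow> complex" where
  "centroid I = moment I 1 0 / moment I 0 0"

definition centralized_moment :: "image \<Rightarrow> nat \<Rightarrow> nat \<Rightarrow> complex" where
  "centralized_moment I j l =
     (\<Sum>(z, r)\<in>I. (z - centroid I) ^ j * (cnj z - cnj (centroid I)) ^ l * of_real r)"

definition rotate_image :: "complex \<Rightarrow> real \<Rightarrow> image \<Rightarrow> image" where
  "rotate_image c \<theta> I = (\<lambda>(z, r). (c + cis \<theta> * (z - c), r)) ` I"

definition rotation_symmetric :: "nat \<Rightarrow> image \<Rightarrow> bool" where
  "rotation_symmetric n I \<longleftrightarrow>
     (\<forall>k\<in>{1..n}. image_eq (rotate_image (centroid I) (2 * real k * pi / real n) I) I)"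

end

theory Submission
  imports Defs "HOL-Computational_Algebra.Polynomial"
begin

text \<open>Rotating an image about \<open>c\<close> by \<open>\<theta>\<close> multiplies its moment of index \<open>(j, l)\<close> about \<open>c\<close> by
  \<open>cis (\<theta> * (j - l))\<close>. For \<open>\<theta> = 2 * \<pi> / n\<close> this factor differs from \<open>1\<close> unless \<open>n\<close> divides
  \<open>l - j\<close>, so the moments of a symmetric image vanish. If they vanish, all rotations by multiples of
  \<open>2 * \<pi> / n\<close> preserve every moment. An image is determined by its moments, in fact by those with
  \<open>l = 0\<close>: by linearity they give \<open>\<Sum> p (z - c) * \<rho> z\<close> for every polynomial \<open>p\<close>, and a \<open>p\<close> that
  vanishes at all pixels but one isolates the intensity of that pixel.\<close>

text \<open>The centre \<open>c\<close> is free so that a rotated image can be measured about the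
  centroid of the original image.\<close>

definition moment_about :: "complex \<Rightarrow> image \<Rightarrow> nat \<Rightarrow> nat \<Rightarrow> complex" where
  "moment_about c I j l = (\<Sum>(z, r)\<in>I. (z - c) ^ j * cnj (z - c) ^ l * of_real r)"

lemma centralized_moment_eq_moment_about:
  "centralized_moment I j l = moment_about (centroid I) I j l"
  by (simp add: centralized_moment_def moment_about_def)

text \<open>Pixels of zero intensity contribute nothing to the sum.\<close>

lemma moment_about_image_eq:
  assumes "image_eq I J" "finite I" "finite J"
  shows "moment_about c I j l = moment_about c J j l"
proof -
  have nonzero_part:
    "moment_about c K j l = moment_about c {(z, r) \<in> K. r \<noteq> 0} j l" if "finite K" for K
    unfolding moment_about_def by (rule sum.mono_neutral_right) (use that in auto)
  show ?thesis
    using assms nonzero_part[of I] nonzero_part[of J] by (simp add: image_eq_def)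
qed

lemma gray_image_rotate_image:
  assumes "gray_image I"
  shows "gray_image (rotate_image c \<theta> I)"
  using assms unfolding gray_image_def rotate_image_def inj_on_def by force

lemma cis_power_mult_cnj_power: "cis \<theta> ^ j * cnj (cis \<theta>) ^ l = cis (\<theta> * (real j - real l))"
  by (simp add: cis_cnj Complex.DeMoivre cis_mult algebra_simps)

lemma moment_about_rotate_image:
  "moment_about c (rotate_image c \<theta> I) j l =
     cis (\<theta> * (real j - real l)) * moment_about c I j l"
proof -
  have "inj_on (\<lambda>(z, r). (c + cis \<theta> * (z - c), r)) I"
    by (auto simp: inj_on_def)
  then have "moment_about c (rotate_image c \<theta> I) j l =
      (\<Sum>(z, r)\<in>I. (cis \<theta> * (z - c)) ^ j * cnj (cis \<theta> * (z - c)) ^ l * of_real r)"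
    unfolding moment_about_def rotate_image_def
    by (subst sum.reindex) (auto intro!: sum.cong)
  also have "\<dots> = (\<Sum>(z, r)\<in>I. cis \<theta> ^ j * cnj (cis \<theta>) ^ l *
      ((z - c) ^ j * cnj (z - c) ^ l * of_real r))"
    by (intro sum.cong refl)
      (simp only: power_mult_distrib complex_cnj_mult split_def mult_ac)
  also have "\<dots> = cis \<theta> ^ j * cnj (cis \<theta>) ^ l * moment_about c I j l"
    by (simp add: moment_about_def sum_distrib_left split_def)
  finally show ?thesis
    by (simp only: cis_power_mult_cnj_power)
qed

lemma cis_eq_1_iff: "cis x = 1 \<longleftrightarrow> (\<exists>m::int. x = of_int m * 2 * pi)"
proof
  assume "cis x = 1"
  then have "cos x = 1" by (simp add: complex_eq_iff)
  then show "\<exists>m::int. x = of_int m * 2 * pi" by (simp add: cos_one_2pi_int)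
next
  assume "\<exists>m::int. x = of_int m * 2 * pi"
  then obtain m :: int where "x = 2 * pi * of_int m" by (auto simp: mult_ac)
  then show "cis x = 1" by (simp add: cis_multiple_2pi)
qed

lemma sum_poly_eq_moments:
  "(\<Sum>(z, r)\<in>I. poly p (z - c) * of_real r) =
     (\<Sum>i\<le>degree p. coeff p i * moment_about c I i 0)"
proof -
  have "(\<Sum>(z, r)\<in>I. poly p (z - c) * of_real r) =
      (\<Sum>x\<in>I. \<Sum>i\<le>degree p. coeff p i * ((fst x - c) ^ i * of_real (snd x)))"
    by (simp add: poly_altdef split_def sum_distrib_right mult.assoc)
  also have "\<dots> = (\<Sum>i\<le>degree p. \<Sum>x\<in>I. coeff p i * ((fst x - c) ^ i * of_real (snd x)))"
    by (rule sum.swap)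
  finally show ?thesis
    by (simp add: moment_about_def split_def sum_distrib_left)
qed

text \<open>This is one inclusion between the nonzero parts of two images; exchanging
  \<open>I\<close> and \<open>J\<close> gives the other.\<close>

lemma pixel_mem_if_moments_eq:
  assumes I: "finite I" "inj_on fst I" and J: "finite J" "inj_on fst J"
    and eq: "\<And>i. moment_about c I i 0 = moment_about c J i 0"
    and mem: "(a, r) \<in> I" and "r \<noteq> 0"
  shows "(a, r) \<in> J"
proof -
  \<comment> \<open>\<open>S\<close> collects locations from both images, so that a single
    \<open>p\<close> isolates \<open>a\<close> in each of them. The roots are shifted by
    \<open>c\<close> because the moments are taken in \<open>z - c\<close>.\<close>
  define S where "S = (fst ` I \<union> fst ` J) - {a}"
  define p where "p = (\<Prod>s\<in>S. [:- (s - c), 1:])"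
  have "finite S" using I J by (simp add: S_def)
  then have p_0: "poly p (s - c) = 0" if "s \<in> S" for s
    using that by (auto simp: p_def poly_prod)
  have p_a: "poly p (a - c) \<noteq> 0"
    using \<open>finite S\<close> by (auto simp: p_def poly_prod S_def)
  have isolate: "(\<Sum>(z, t)\<in>K. poly p (z - c) * of_real t) =
      (\<Sum>(z, t)\<in>{x \<in> K. fst x = a}. poly p (z - c) * of_real t)"
    if "finite K" "fst ` K \<subseteq> insert a S" for K
    by (rule sum.mono_neutral_right) (use that p_0 in force)+
  have "{x \<in> I. fst x = a} = {(a, r)}"
    using mem inj_onD[OF I(2)] by fastforce
  \<comment> \<open>Equal moments give \<open>I\<close> and \<open>J\<close> the same full sum for
    \<open>p\<close>; on the side of \<open>I\<close> only the pixel \<open>(a, r)\<close>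
    survives.\<close>
  then have "(\<Sum>(z, t)\<in>{x \<in> J. fst x = a}. poly p (z - c) * of_real t) = poly p (a - c) * of_real r"
    using isolate[of I] isolate[of J] I J sum_poly_eq_moments[of p c I] sum_poly_eq_moments[of p c J]
    by (simp add: eq S_def subset_iff)
  \<comment> \<open>Without a pixel of \<open>J\<close> at \<open>a\<close> the left sum would be
    empty, while the right side is nonzero.\<close>
  moreover from this have "{x \<in> J. fst x = a} \<noteq> {}"
    using p_a \<open>r \<noteq> 0\<close> by (intro notI) simp
  then obtain t where t: "(a, t) \<in> J" by auto
  then have "{x \<in> J. fst x = a} = {(a, t)}"
    using inj_onD[OF J(2)] by fastforce
  ultimately have "t = r" using p_a by simp
  with t show ?thesis by simp
qed

lemma image_eq_if_moments_eq:
  assumes "gray_image I" "gray_image J"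
    and "\<And>i. moment_about c I i 0 = moment_about c J i 0"
  shows "image_eq I J"
  using assms pixel_mem_if_moments_eq[of I J c] pixel_mem_if_moments_eq[of J I c]
  unfolding image_eq_def gray_image_def by auto

lemma vanishing_moment_if_rotation_symmetric:
  assumes n: "n \<ge> 1" and I: "gray_image I" and sym: "rotation_symmetric n I"
    and nonint: "(real l - real j) / real n \<notin> \<int>"
  shows "centralized_moment I j l = 0"
proof -
  let ?c = "centroid I" and ?\<theta> = "2 * pi / real n"
  \<comment> \<open>The rotation with \<open>k = 1\<close> is chosen because its factor differs from
    1 whenever \<open>n\<close> does not divide \<open>l - j\<close>.\<close>
  have "image_eq (rotate_image ?c ?\<theta> I) I"
    using sym n by (auto simp: rotation_symmetric_def dest!: bspec[of _ _ 1])
  then have "moment_about ?c I j l = cis (?\<theta> * (real j - real l)) * moment_about ?c I j l"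
    using moment_about_image_eq gray_image_rotate_image I moment_about_rotate_image
    by (metis gray_image_def)
  moreover have "cis (?\<theta> * (real j - real l)) \<noteq> 1"
  proof
    assume "cis (?\<theta> * (real j - real l)) = 1"
    then obtain m :: int where "?\<theta> * (real j - real l) = of_int m * 2 * pi"
      by (auto simp: cis_eq_1_iff)
    then have "pi * (real j - real l) = pi * (of_int m * real n)"
      using n by (simp add: field_simps)
    then have "real j - real l = of_int m * real n"
      by simp
    then have "(real l - real j) / real n = of_int (- m)"
      using n by (simp add: field_simps)
    with nonint show False by (metis Ints_of_int)
  qed
  ultimately show ?thesis
    by (simp add: centralized_moment_eq_moment_about)
qed

text \<open>The hypothesis concerns only \<open>l = 0\<close>, since these moments determine an
  image.\<close>

lemma rotation_symmetric_if_vanishing_moments: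
  assumes n: "n \<ge> 1" and I: "gray_image I"
    and vanish: "\<And>j. real j / real n \<notin> \<int> \<Longrightarrow> centralized_moment I j 0 = 0"
  shows "rotation_symmetric n I"
  unfolding rotation_symmetric_def
proof
  fix k
  let ?c = "centroid I" and ?\<theta> = "2 * real k * pi / real n"
  have "moment_about ?c (rotate_image ?c ?\<theta> I) j 0 = moment_about ?c I j 0" for j
  \<comment> \<open>If \<open>n\<close> divides \<open>j\<close>, the rotation factor is 1;
    otherwise both moments vanish.\<close>
  proof (cases "real j / real n \<in> \<int>")
    case True
    then obtain m :: int where "real j / real n = of_int m" by (auto elim: Ints_cases)
    then have "?\<theta> * real j = of_int (int k * m) * 2 * pi"
      using n by (simp add: field_simps)
    then have "cis (?\<theta> * real j) = 1"
      unfolding cis_eq_1_iff by blast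
    then show ?thesis by (simp add: moment_about_rotate_image)
  next
    case False
    then show ?thesis
      using vanish by (simp add: moment_about_rotate_image centralized_moment_eq_moment_about)
  qed
  then show "image_eq (rotate_image ?c ?\<theta> I) I"
    using image_eq_if_moments_eq gray_image_rotate_image I by blast
qed

theorem lemma12:
  fixes n :: nat and I :: image
  assumes "n \<ge> 1" and "gray_image I" and "moment I 0 0 \<noteq> 0"
  shows "(rotation_symmetric n I \<longrightarrow>
           (\<forall>j l :: nat. (real l - real j) / real n \<notin> \<int> \<longrightarrow> centralized_moment I j l = 0)) \<and>
         ((\<forall>j l :: nat. (real l - real j) / real n \<notin> \<int> \<longrightarrow> centralized_moment I j l = 0) \<longrightarrow>
           rotation_symmetric n I)"
proof (intro conjI impI allI)
  fix j l :: nat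
  assume "rotation_symmetric n I" "(real l - real j) / real n \<notin> \<int>"
  then show "centralized_moment I j l = 0"
    using vanishing_moment_if_rotation_symmetric assms(1,2) by blast
next
  assume vanish:
    "\<forall>j l :: nat. (real l - real j) / real n \<notin> \<int> \<longrightarrow> centralized_moment I j l = 0"
  \<comment> \<open>This is the case \<open>l = 0\<close>: \<open>- j / n\<close> is an integer
    exactly when \<open>j / n\<close> is.\<close>
  have "centralized_moment I j 0 = 0" if "real j / real n \<notin> \<int>" for j
    using vanish[rule_format, of 0 j] that by simp
  then show "rotation_symmetric n I"
    using rotation_symmetric_if_vanishing_moments assms(1,2) by blast
qed

end
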